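(* Let $\{x^t\}_{t\ge 0}$ be the iterates of the multiplicative gradient (MG) method started from some $x^0\in\Delta_n$ with $x^0>0$ (entrywise). Then there exists some $x^*\in\mathcal{X}^*$ such that $x^t\to x^*$ as $t\to+\infty$.
   Context: Let $m,n\ge 1$, $[n]=\{1,\dots,n\}$, and $\Delta_n=\{x\in\mathbb{R}^n: x\ge 0,\ \sum_{i=1}^n x_i=1\}$. Let $p_1,\dots,p_m>0$ with $\sum_{j=1}^m p_j=1$, and let $a_1,\dots,a_m\in\mathbb{R}^n$ be entrywise nonnegative and nonzero; $a_{ji}$ is the $i$-th entry of $a_j$. Let $f(x)=\sum_{j=1}^m p_j\ln(a_j^\top x)$ (with $\ln 0=-\infty$), and let $\mathcal{X}^*\neq\emptyset$ be the set of maximizers of $f$ over $\Delta_n$. MG method: given $x^0\in\Delta_n$ with all entries positive, for $t\ge 0$ set $x_i^{t+1}=x_i^t\,\nabla_i f(x^t)$ for all $i\in[n]$, where $\nabla_i f(x)=\sum_{j=1}^m p_j\frac{a_{ji}}{a_j^\top x}$. (All iterates lie in $\Delta_n$ and satisfy $a_j^\top x^t>0$ for all $j$, so the method is well defined.) *)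

theory Defs
  imports "HOL-Analysis.Analysis"
begin

definition prob_simplex :: "(real ^ 'n) set" where
  "prob_simplex = {x. (\<forall>i. 0 \<le> x $ i) \<and> (\<Sum>i\<in>UNIV. x $ i) = 1}"

text \<open>
  The real function \<^const>\<open>ln\<close> satisfies \<open>ln 0 = 0\<close>; the objective needs \<open>ln 0 = -\<infinity>\<close>.
  Only arguments \<open>y \<ge> 0\<close> are relevant.
\<close>

definition ext_ln :: "real \<Rightarrow> ereal" where
  "ext_ln y = (if 0 < y then ereal (ln y) else -\<infinity>)"

definition objective :: "('m::finite \<Rightarrow> real) \<Rightarrow> ('m \<Rightarrow> real ^ 'n) \<Rightarrow> real ^ 'n \<Rightarrow> ereal" where
  "objective p a x = (\<Sum>j\<in>UNIV. ereal (p j) * ext_ln (a j \<bullet> x))"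

definition maximizers :: "('m::finite \<Rightarrow> real) \<Rightarrow> ('m \<Rightarrow> real ^ 'n) \<Rightarrow> (real ^ 'n) set" where
  "maximizers p a = {x. is_arg_max (objective p a) (\<lambda>y. y \<in> prob_simplex) x}"

definition grad :: "('m::finite \<Rightarrow> real) \<Rightarrow> ('m \<Rightarrow> real ^ 'n) \<Rightarrow> real ^ 'n \<Rightarrow> real ^ 'n" where
  "grad p a x = (\<chi> i. \<Sum>j\<in>UNIV. p j * (a j $ i / (a j \<bullet> x)))"

text \<open>
  The quotients in \<^const>\<open>grad\<close> are never divisions by zero along an MG sequence when the vectors
  \<open>a j\<close> are nonnegative and nonzero and the weights \<open>p j\<close> are positive: all iterates then stay
  entrywise nonnegative with \<open>a j \<bullet> x t > 0\<close>.
\<close>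

definition MG_iterates ::
    "('m::finite \<Rightarrow> real) \<Rightarrow> ('m \<Rightarrow> real ^ 'n) \<Rightarrow> (nat \<Rightarrow> real ^ 'n) \<Rightarrow> bool" where
  "MG_iterates p a x \<longleftrightarrow>
     x 0 \<in> prob_simplex \<and> (\<forall>i. 0 < x 0 $ i) \<and>
     (\<forall>t i. x (Suc t) $ i = x t $ i * grad p a (x t) $ i)"

end

theory Submission
  imports Defs
begin

text \<open>
  For a maximizer \<open>x\<^sup>*\<close>, Jensen's inequality and the stationarity of \<open>x\<^sup>*\<close> show that the relative
  entropy of \<open>x\<^sup>*\<close> with respect to \<open>x\<^sup>t\<close> drops at step \<open>t\<close> by at least \<open>f(x\<^sup>*) - f(x\<^sup>t)\<close>. Hence these gaps
  are summable and every limit point of the iterates is a maximizer. The relative entropy of such a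
  limit point is nonincreasing along the iterates and tends to zero along a subsequence, hence
  tends to zero; as it dominates the squared Hellinger distance, the whole sequence converges.
  Stationarity itself needs no derivatives: a step of the method raises \<open>f\<close> by at least the relative
  entropy of the new point with respect to the old one, so it fixes every maximizer.
\<close>

section \<open>Jensen's inequality for the logarithm\<close>

text \<open>With \<open>s\<close> the weighted mean, the tangent bound
  \<open>ln u \<le> u - 1\<close> at \<open>u = y k / s\<close> is averaged; its right-hand sides
  sum to zero. Positivity of \<open>y\<close> is tied to positive weights because gradient entries,
  to which this is applied, can vanish.\<close>

lemma jensen_ln:
  fixes w y :: "'k \<Rightarrow> real"
  assumes "finite S" and w: "\<And>k. k \<in> S \<Longrightarrow> 0 \<le> w k" and w1: "sum w S = 1"
    and y: "\<And>k. k \<in> S \<Longrightarrow> 0 < w k \<Longrightarrow> 0 < y k"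
  shows "(\<Sum>k\<in>S. w k * ln (y k)) \<le> ln (\<Sum>k\<in>S. w k * y k)"
proof -
  define s where "s = (\<Sum>k\<in>S. w k * y k)"
  obtain l where l: "l \<in> S" "0 < w l"
    using w w1 by (metis less_eq_real_def sum.neutral zero_neq_one)
  have nonneg: "0 \<le> w k * y k" if "k \<in> S" for k
    using w[OF that] y[OF that] by (cases "w k = 0") auto
  have "0 < s" unfolding s_def
    using l y nonneg by (intro sum_pos2[OF \<open>finite S\<close>, of l]) auto
  have "w k * ln (y k) \<le> w k * ln s + (w k * y k / s - w k)" if "k \<in> S" for k
  proof (cases "w k = 0")
    case False
    hence "0 < w k" and "0 < y k" using w[OF that] y[OF that] by auto
    have "ln (y k) - ln s \<le> y k / s - 1"
      using ln_le_minus_one[of "y k / s"] \<open>0 < y k\<close> \<open>0 < s\<close> by (simp add: ln_div)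
    hence "w k * (ln (y k) - ln s) \<le> w k * (y k / s - 1)"
      using \<open>0 < w k\<close> by (intro mult_left_mono) auto
    thus ?thesis by (simp add: algebra_simps)
  qed simp
  hence "(\<Sum>k\<in>S. w k * ln (y k)) \<le> (\<Sum>k\<in>S. w k * ln s + (w k * y k / s - w k))"
    by (rule sum_mono)
  also have "\<dots> = ln s"
    using \<open>0 < s\<close> by (simp add: sum.distrib sum_subtractf w1 s_def
        flip: sum_distrib_right sum_divide_distrib)
  finally show ?thesis by (simp add: s_def)
qed

section \<open>Relative entropy on the simplex\<close>

text \<open>Since \<open>y / 0 = 0\<close> and \<open>ln 0 = 0\<close>, a coordinate with
  \<open>y $ i > 0\<close> and \<open>x $ i = 0\<close> contributes 0 where the true value is
  infinite; the support hypotheses below exclude this case.\<close>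

definition rel_entropy :: "real ^ 'n \<Rightarrow> real ^ 'n \<Rightarrow> real" where
  "rel_entropy y x = (\<Sum>i\<in>UNIV. y $ i * ln (y $ i / x $ i))"

text \<open>Coordinatewise, \<open>ln u \<le> u - 1\<close> at
  \<open>u = sqrt (x $ i / y $ i)\<close> bounds the entropy term below by \<open>2 * y $ i\<close>
  minus twice the geometric mean. Both totals being 1, these bounds sum to the Hellinger
  expression.\<close>

lemma hellinger_le_rel_entropy:
  assumes y: "y \<in> prob_simplex" and x: "x \<in> prob_simplex"
    and supp: "\<And>i. 0 < y $ i \<Longrightarrow> 0 < x $ i"
  shows "(\<Sum>i\<in>UNIV. (sqrt (y $ i) - sqrt (x $ i))\<^sup>2) \<le> rel_entropy y x"
proof -
  have y0: "0 \<le> y $ i" and x0: "0 \<le> x $ i" for i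
    using x y by (auto simp: prob_simplex_def)
  have "2 * y $ i - 2 * (sqrt (y $ i) * sqrt (x $ i)) \<le> y $ i * ln (y $ i / x $ i)" for i
  proof (cases "y $ i = 0")
    case False
    hence yi: "0 < y $ i" and xi: "0 < x $ i" using y0[of i] supp[of i] by auto
    define u where "u = sqrt (x $ i) / sqrt (y $ i)"
    have u: "0 < u" using yi xi by (simp add: u_def)
    have "ln (y $ i / x $ i) = - 2 * ln u"
      using yi xi by (simp add: u_def ln_div ln_sqrt)
    moreover have "ln u \<le> u - 1" using u by (rule ln_le_minus_one)
    ultimately have "2 * (1 - u) \<le> ln (y $ i / x $ i)" by simp
    hence "y $ i * (2 * (1 - u)) \<le> y $ i * ln (y $ i / x $ i)"
      using yi by (intro mult_left_mono) auto
    moreover have "y $ i * u = sqrt (y $ i) * sqrt (x $ i)"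
      using yi by (simp add: u_def field_simps flip: power2_eq_square)
    ultimately show ?thesis by (simp add: algebra_simps)
  qed simp
  hence "(\<Sum>i\<in>UNIV. 2 * y $ i - 2 * (sqrt (y $ i) * sqrt (x $ i))) \<le> rel_entropy y x"
    unfolding rel_entropy_def by (intro sum_mono)
  moreover have "(\<Sum>i\<in>UNIV. (sqrt (y $ i) - sqrt (x $ i))\<^sup>2)
      = (\<Sum>i\<in>UNIV. y $ i + x $ i - 2 * (sqrt (y $ i) * sqrt (x $ i)))"
    using x0 y0 by (simp add: power2_diff mult.assoc)
  ultimately show ?thesis
    using x y by (simp add: prob_simplex_def sum.distrib sum_subtractf flip: sum_distrib_left)
qed

lemma rel_entropy_nonneg:
  assumes "y \<in> prob_simplex" "x \<in> prob_simplex" "\<And>i. 0 < y $ i \<Longrightarrow> 0 < x $ i"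
  shows "0 \<le> rel_entropy y x"
  using hellinger_le_rel_entropy[OF assms] by (smt (verit) sum_nonneg zero_le_power2)

lemma rel_entropy_zero_imp_eq:
  assumes y: "y \<in> prob_simplex" and x: "x \<in> prob_simplex"
    and "\<And>i. 0 < y $ i \<Longrightarrow> 0 < x $ i" and "rel_entropy y x \<le> 0"
  shows "y = x"
proof -
  have "(\<Sum>i\<in>UNIV. (sqrt (y $ i) - sqrt (x $ i))\<^sup>2) \<le> 0"
    using hellinger_le_rel_entropy[OF assms(1-3)] assms(4) by simp
  hence "(\<Sum>i\<in>UNIV. (sqrt (y $ i) - sqrt (x $ i))\<^sup>2) = 0"
    by (simp add: antisym sum_nonneg)
  hence "sqrt (y $ i) = sqrt (x $ i)" for i
    by (simp add: sum_nonneg_eq_0_iff)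
  thus ?thesis by (simp add: vec_eq_iff)
qed

lemma compact_prob_simplex: "compact (prob_simplex :: (real ^ 'n) set)"
proof -
  have "norm x \<le> 1" if "x \<in> prob_simplex" for x :: "real ^ 'n"
    using norm_le_l1_cart[of x] that by (simp add: prob_simplex_def)
  hence "bounded (prob_simplex :: (real ^ 'n) set)" by (auto simp: bounded_iff)
  moreover have "closed (prob_simplex :: (real ^ 'n) set)"
    unfolding prob_simplex_def
    by (intro closed_Collect_conj closed_Collect_all closed_Collect_le closed_Collect_eq
        continuous_intros)
  ultimately show ?thesis by (simp add: compact_eq_bounded_closed)
qed

text \<open>Coordinates with \<open>z $ i = 0\<close> contribute exactly 0 for every
  \<open>k\<close>; on the others the ratio tends to 1, where \<open>ln\<close> is
  continuous.\<close>

lemma tendsto_rel_entropy_self: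
  assumes z: "z \<in> prob_simplex" and lim: "X \<longlonglongrightarrow> z"
  shows "(\<lambda>k. rel_entropy z (X k)) \<longlonglongrightarrow> 0"
proof -
  have "(\<lambda>k. z $ i * ln (z $ i / X k $ i)) \<longlonglongrightarrow> 0" for i
  proof (cases "z $ i = 0")
    case False
    have "(\<lambda>k. X k $ i) \<longlonglongrightarrow> z $ i" using lim by (rule tendsto_vec_nth)
    hence "(\<lambda>k. z $ i * ln (z $ i / X k $ i)) \<longlonglongrightarrow> z $ i * ln (z $ i / z $ i)"
      using False by (intro tendsto_mult tendsto_ln tendsto_divide tendsto_const) auto
    thus ?thesis using False by simp
  qed simp
  thus ?thesis unfolding rel_entropy_def by (rule tendsto_null_sum)
qed

text \<open>The Hellinger bound squeezes the differences of the square roots to 0, and squaring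
  recovers the coordinates.\<close>

lemma tendsto_of_rel_entropy:
  assumes z: "z \<in> prob_simplex" and X: "\<And>k. X k \<in> prob_simplex"
    and supp: "\<And>k i. 0 < z $ i \<Longrightarrow> 0 < X k $ i"
    and lim: "(\<lambda>k. rel_entropy z (X k)) \<longlonglongrightarrow> 0"
  shows "X \<longlonglongrightarrow> z"
proof (rule vec_tendstoI)
  fix i
  have le: "(sqrt (z $ i) - sqrt (X k $ i))\<^sup>2 \<le> rel_entropy z (X k)" for k
    by (rule order_trans[OF _ hellinger_le_rel_entropy[OF z X supp]])
      (auto intro: member_le_sum)
  have "(\<lambda>k. (sqrt (z $ i) - sqrt (X k $ i))\<^sup>2) \<longlonglongrightarrow> 0"
    by (rule tendsto_sandwich[OF _ _ tendsto_const lim]) (use le in auto)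
  hence "(\<lambda>k. sqrt (z $ i) - sqrt (X k $ i)) \<longlonglongrightarrow> 0"
    by (simp add: tendsto_null_power)
  hence "(\<lambda>k. sqrt (z $ i) - (sqrt (z $ i) - sqrt (X k $ i))) \<longlonglongrightarrow> sqrt (z $ i) - 0"
    by (intro tendsto_intros)
  hence "(\<lambda>k. (sqrt (X k $ i))\<^sup>2) \<longlonglongrightarrow> (sqrt (z $ i))\<^sup>2"
    by (intro tendsto_power) simp
  thus "(\<lambda>k. X k $ i) \<longlonglongrightarrow> z $ i"
    using z X by (simp add: prob_simplex_def)
qed

section \<open>The objective on its finite domain, and the step map\<close>

locale mg_problem =
  fixes p :: "'m::finite \<Rightarrow> real" and a :: "'m \<Rightarrow> real ^ 'n"
  assumes p_pos: "\<And>j. 0 < p j"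
    and p_sum: "(\<Sum>j\<in>UNIV. p j) = 1"
    and a_nonneg: "\<And>j i. 0 \<le> a j $ i"
begin

definition F :: "real ^ 'n \<Rightarrow> real" where
  "F x = (\<Sum>j\<in>UNIV. p j * ln (a j \<bullet> x))"

text \<open>The part of the simplex on which the objective is finite. \<open>F\<close> is compared
  only between points of this set, because elsewhere the real \<open>ln\<close> does not represent
  the objective.\<close>

definition dom :: "(real ^ 'n) set" where
  "dom = {x \<in> prob_simplex. \<forall>j. 0 < a j \<bullet> x}"

definition optimal :: "real ^ 'n \<Rightarrow> bool" where
  "optimal x \<longleftrightarrow> x \<in> dom \<and> (\<forall>y\<in>dom. F y \<le> F x)"

definition step :: "real ^ 'n \<Rightarrow> real ^ 'n" where
  "step x = (\<chi> i. x $ i * grad p a x $ i)"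

lemma dom_simplex: "x \<in> dom \<Longrightarrow> x \<in> prob_simplex"
  and dom_nonneg: "x \<in> dom \<Longrightarrow> 0 \<le> x $ i"
  and dom_sum: "x \<in> dom \<Longrightarrow> (\<Sum>i\<in>UNIV. x $ i) = 1"
  and dom_pos: "x \<in> dom \<Longrightarrow> 0 < a j \<bullet> x"
  by (auto simp: dom_def prob_simplex_def)

lemma dom_neq_0: "x \<in> dom \<Longrightarrow> a j \<bullet> x \<noteq> 0"
  using dom_pos[of x j] by linarith

lemma inner_eq_sum: "a j \<bullet> x = (\<Sum>i\<in>UNIV. a j $ i * x $ i)"
  by (simp add: inner_vec_def)

lemma grad_nonneg: "x \<in> dom \<Longrightarrow> 0 \<le> grad p a x $ i"
  unfolding grad_def
  by (auto intro!: sum_nonneg mult_nonneg_nonneg divide_nonneg_nonneg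
      simp: a_nonneg less_imp_le[OF p_pos] less_imp_le[OF dom_pos])

lemma grad_pos:
  assumes x: "x \<in> dom" and "0 < a j $ i"
  shows "0 < grad p a x $ i"
proof -
  have "0 < (\<Sum>j\<in>UNIV. p j * (a j $ i / (a j \<bullet> x)))"
  proof (rule sum_pos2[of _ j])
    show "0 < p j * (a j $ i / (a j \<bullet> x))"
      using assms p_pos dom_pos[OF x] by simp
    show "0 \<le> p k * (a k $ i / (a k \<bullet> x))" for k
      using a_nonneg p_pos[of k] dom_pos[OF x, of k] by simp
  qed auto
  thus ?thesis by (simp add: grad_def)
qed

text \<open>On \<open>dom\<close>, whether a gradient entry is positive depends only on whether some
  \<open>a j $ i\<close> is nonzero, not on the point.\<close>

lemma grad_pos_cong:
  assumes "x \<in> dom" "0 < grad p a x $ i" "y \<in> dom"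
  shows "0 < grad p a y $ i"
proof -
  have "\<exists>j. a j $ i \<noteq> 0"
    by (rule ccontr) (use assms(2) in \<open>simp add: grad_def\<close>)
  then obtain j where "0 < a j $ i" using a_nonneg by (metis less_eq_real_def)
  thus ?thesis using grad_pos assms(3) by blast
qed

text \<open>For \<open>x\<close> in \<open>dom\<close>, the masses
  \<open>x $ i * grad p a x $ i\<close> are the mixture, with weights \<open>p j\<close>, of the
  probability vectors in \<open>weights_sum\<close>. Taking \<open>c = 1\<close> gives the total
  mass of a step; taking \<open>c\<close> as the logarithm of the gradient gives the entropy of a
  step.\<close>

lemma sum_grad:
  "(\<Sum>i\<in>UNIV. x $ i * grad p a x $ i * c i)
    = (\<Sum>j\<in>UNIV. p j * (\<Sum>i\<in>UNIV. a j $ i * x $ i / (a j \<bullet> x) * c i))"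
  unfolding grad_def vec_lambda_beta sum_distrib_left sum_distrib_right
  by (subst sum.swap) (simp add: mult_ac)

lemma weights_sum: "x \<in> dom \<Longrightarrow> (\<Sum>i\<in>UNIV. a j $ i * x $ i / (a j \<bullet> x)) = 1"
  using dom_pos[of x j] by (simp flip: inner_eq_sum sum_divide_distrib)

lemma step_in_dom:
  assumes x: "x \<in> dom"
  shows "step x \<in> dom"
proof -
  have "(\<Sum>i\<in>UNIV. step x $ i) = 1"
    using sum_grad[of x "\<lambda>_. 1"] weights_sum[OF x] p_sum by (simp add: step_def)
  moreover have nn: "0 \<le> step x $ i" for i
    using grad_nonneg[OF x] dom_nonneg[OF x] by (simp add: step_def)
  moreover have "0 < a j \<bullet> step x" for j
  proof -
    have "(\<Sum>i\<in>UNIV. a j $ i * x $ i) \<noteq> 0"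
      using dom_pos[OF x, of j] by (simp add: inner_eq_sum)
    then obtain i where "a j $ i * x $ i \<noteq> 0" by (metis (no_types) sum.neutral)
    hence i: "0 < a j $ i" "0 < x $ i"
      using a_nonneg[of j i] dom_nonneg[OF x, of i] by auto
    hence "0 < a j $ i * step x $ i"
      using grad_pos[OF x] by (simp add: step_def)
    thus ?thesis unfolding inner_eq_sum
      using a_nonneg nn by (intro sum_pos2[of _ i]) auto
  qed
  ultimately show ?thesis by (simp add: dom_def prob_simplex_def)
qed

section \<open>Ascent of the objective, stationarity, and descent of the entropy\<close>

text \<open>Where \<open>x $ i > 0\<close>, the ratio \<open>step x $ i / x $ i\<close> is the
  gradient entry, so \<open>sum_grad\<close> turns the entropy into an average over \<open>j\<close>
  of averages over \<open>i\<close>. Jensen is applied to the inner average, for each fixed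
  \<open>j\<close>.\<close>

lemma step_ascent:
  assumes x: "x \<in> dom"
  shows "F x + rel_entropy (step x) x \<le> F (step x)"
proof -
  have "rel_entropy (step x) x = (\<Sum>i\<in>UNIV. x $ i * grad p a x $ i * ln (grad p a x $ i))"
    unfolding rel_entropy_def by (intro sum.cong) (auto simp: step_def)
  also have "\<dots> = (\<Sum>j\<in>UNIV. p j * (\<Sum>i\<in>UNIV. a j $ i * x $ i / (a j \<bullet> x) * ln (grad p a x $ i)))"
    by (rule sum_grad)
  also have "\<dots> \<le> (\<Sum>j\<in>UNIV. p j * ln (\<Sum>i\<in>UNIV. a j $ i * x $ i / (a j \<bullet> x) * grad p a x $ i))"
  proof (intro sum_mono mult_left_mono jensen_ln weights_sum[OF x])
    fix j i
    show "0 \<le> p j" using p_pos[of j] by simp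
    show "0 \<le> a j $ i * x $ i / (a j \<bullet> x)"
      using a_nonneg dom_nonneg[OF x] dom_pos[OF x, of j] by simp
    assume "0 < a j $ i * x $ i / (a j \<bullet> x)"
    hence "a j $ i \<noteq> 0" by auto
    hence "0 < a j $ i" using a_nonneg[of j i] by simp
    thus "0 < grad p a x $ i" by (rule grad_pos[OF x])
  qed auto
  \<comment> \<open>Weighting the gradient by \<open>a j $ i * x $ i\<close> reassembles
    \<open>a j \<bullet> step x\<close>.\<close>
  also have "\<dots> = (\<Sum>j\<in>UNIV. p j * ln ((a j \<bullet> step x) / (a j \<bullet> x)))"
    by (simp add: inner_eq_sum step_def sum_divide_distrib mult_ac)
  also have "\<dots> = F (step x) - F x"
    unfolding F_def sum_subtractf[symmetric]
    using dom_pos[OF x] dom_pos[OF step_in_dom[OF x]]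
    by (intro sum.cong) (auto simp: ln_div dom_neq_0 x step_in_dom right_diff_distrib)
  finally show ?thesis by simp
qed

lemma optimal_step:
  assumes "optimal x"
  shows "step x = x"
proof -
  have x: "x \<in> dom" using assms by (simp add: optimal_def)
  have "F (step x) \<le> F x" using assms step_in_dom[OF x] by (simp add: optimal_def)
  hence "rel_entropy (step x) x \<le> 0" using step_ascent[OF x] by simp
  moreover have "0 < step x $ i \<Longrightarrow> 0 < x $ i" for i
    using dom_nonneg[OF x, of i] by (cases "x $ i = 0") (auto simp: step_def)
  ultimately show ?thesis
    using rel_entropy_zero_imp_eq dom_simplex[OF x] dom_simplex[OF step_in_dom[OF x]] by blast
qed

text \<open>The complementary slackness part of the KKT conditions: on the support, the factor
  \<open>x $ i\<close> cancels from \<open>step x = x\<close>.\<close>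

lemma optimal_grad:
  assumes "optimal x" "0 < x $ i"
  shows "grad p a x $ i = 1"
  using optimal_step[OF assms(1)] assms(2) by (simp add: step_def vec_eq_iff) (metis less_irrefl)

text \<open>A step sets coordinate \<open>i\<close> to 0 when every \<open>a j $ i\<close> is 0, so
  positivity can be lost. On the support of \<open>z\<close> the gradient at \<open>z\<close> is 1,
  which excludes this; hence entropies relative to the iterates keep their meaning.\<close>

lemma step_supp:
  assumes z: "optimal z" and x: "x \<in> dom" and "0 < z $ i" "0 < x $ i"
  shows "0 < step x $ i"
proof -
  have "0 < grad p a z $ i" using optimal_grad[OF z] assms(3) by simp
  hence "0 < grad p a x $ i" using grad_pos_cong z x by (auto simp: optimal_def)
  thus ?thesis using assms(4) by (simp add: step_def)
qed

text \<open>For \<open>i\<close> in the support of \<open>z\<close>, stationarity makes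
  \<open>w i\<close> a probability vector over \<open>j\<close>, and \<open>grad p a x $ i\<close>
  is the mean of the ratios \<open>r j\<close> under it. Jensen thus runs over \<open>j\<close> for
  fixed \<open>i\<close>, the reverse of the roles in \<open>step_ascent\<close>.\<close>

lemma step_descent:
  assumes z: "optimal z" and x: "x \<in> dom" and supp: "\<And>i. 0 < z $ i \<Longrightarrow> 0 < x $ i"
  shows "rel_entropy z (step x) + (F z - F x) \<le> rel_entropy z x"
proof -
  have zd: "z \<in> dom" using z by (simp add: optimal_def)
  define w where "w i j = p j * (a j $ i / (a j \<bullet> z))" for i j
  define r where "r j = (a j \<bullet> z) / (a j \<bullet> x)" for j
  have r: "0 < r j" for j using dom_pos[OF x] dom_pos[OF zd] by (simp add: r_def)
  have gz: "grad p a z $ i = (\<Sum>j\<in>UNIV. w i j)" for i by (simp add: grad_def w_def)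
  have gx: "grad p a x $ i = (\<Sum>j\<in>UNIV. w i j * r j)" for i
    unfolding grad_def vec_lambda_beta w_def r_def
    by (intro sum.cong) (auto simp: dom_neq_0[OF zd])
  have w0: "0 \<le> w i j" for i j
    using p_pos[of j] a_nonneg dom_pos[OF zd, of j] by (simp add: w_def)
  have "F z - F x = (\<Sum>j\<in>UNIV. p j * ln (r j))"
    unfolding F_def sum_subtractf[symmetric] r_def
    using dom_pos[OF x] dom_pos[OF zd]
    by (intro sum.cong) (auto simp: ln_div dom_neq_0 x zd right_diff_distrib)
  \<comment> \<open>The inserted factor is 1; it spreads each \<open>p j\<close> over the
    coordinates so that the sums can be exchanged.\<close>
  also have "\<dots> = (\<Sum>j\<in>UNIV. p j * ((\<Sum>i\<in>UNIV. a j $ i * z $ i / (a j \<bullet> z)) * ln (r j)))"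
    using weights_sum[OF zd] by simp
  also have "\<dots> = (\<Sum>i\<in>UNIV. z $ i * (\<Sum>j\<in>UNIV. w i j * ln (r j)))"
    unfolding sum_distrib_left sum_distrib_right
    by (subst sum.swap) (simp add: w_def mult_ac)
  also have "\<dots> \<le> (\<Sum>i\<in>UNIV. z $ i * ln (grad p a x $ i))"
  proof (rule sum_mono)
    fix i
    show "z $ i * (\<Sum>j\<in>UNIV. w i j * ln (r j)) \<le> z $ i * ln (grad p a x $ i)"
    proof (cases "z $ i = 0")
      case False
      hence "0 < z $ i" using dom_nonneg[OF zd, of i] by simp
      moreover have "(\<Sum>j\<in>UNIV. w i j) = 1"
        using optimal_grad[OF z \<open>0 < z $ i\<close>] gz by simp
      ultimately show ?thesis unfolding gx
        using w0 r by (intro mult_left_mono jensen_ln) auto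
    qed simp
  qed
  also have "\<dots> = rel_entropy z x - rel_entropy z (step x)"
    unfolding rel_entropy_def sum_subtractf[symmetric]
  proof (rule sum.cong)
    fix i
    show "z $ i * ln (grad p a x $ i)
        = z $ i * ln (z $ i / x $ i) - z $ i * ln (z $ i / step x $ i)"
    proof (cases "z $ i = 0")
      case False
      hence "0 < z $ i" using dom_nonneg[OF zd, of i] by simp
      moreover from this have "0 < x $ i" "0 < step x $ i"
        using supp step_supp[OF z x] by auto
      moreover from this have "0 < grad p a x $ i" by (simp add: step_def zero_less_mult_iff)
      ultimately show ?thesis by (simp add: step_def ln_div ln_mult algebra_simps)
    qed simp
  qed simp
  finally show ?thesis by simp
qed

section \<open>Existence of a maximizer\<close>

text \<open>All terms of \<open>F\<close> are bounded above on \<open>dom\<close>, so a single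
  \<open>a j \<bullet> x\<close> close to 0 would push \<open>F x\<close> below \<open>L\<close>.
  This keeps limits of good points inside \<open>dom\<close>.\<close>

lemma F_superlevel_bound:
  obtains c where "\<And>j. 0 < c j" and "\<And>x j. x \<in> dom \<Longrightarrow> L \<le> F x \<Longrightarrow> c j \<le> a j \<bullet> x"
proof
  \<comment> \<open>The summand 1 makes \<open>ln A\<close> nonnegative, so that the missing index
    \<open>j\<close> can be added to the sum of the \<open>p k * ln A\<close> below.\<close>
  define A where "A = 1 + (\<Sum>j\<in>UNIV. \<Sum>i\<in>UNIV. a j $ i)"
  have row: "0 \<le> (\<Sum>i\<in>UNIV. a j $ i)" for j using a_nonneg by (intro sum_nonneg) auto
  have "0 \<le> (\<Sum>j\<in>UNIV. \<Sum>i\<in>UNIV. a j $ i)" by (intro sum_nonneg row)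
  hence A1: "1 \<le> A" by (simp add: A_def)
  have le_A: "a j \<bullet> x \<le> A" if x: "x \<in> dom" for x j
  proof -
    have "x $ i \<le> 1" for i
      using member_le_sum[of i UNIV "\<lambda>i. x $ i"] dom_nonneg[OF x] dom_sum[OF x] by simp
    hence "a j \<bullet> x \<le> (\<Sum>i\<in>UNIV. a j $ i)" unfolding inner_eq_sum
      by (intro sum_mono mult_left_le a_nonneg)
    also have "\<dots> \<le> (\<Sum>j\<in>UNIV. \<Sum>i\<in>UNIV. a j $ i)"
      using row by (intro member_le_sum) auto
    finally show ?thesis by (simp add: A_def)
  qed
  show "0 < exp ((L - ln A) / p j)" for j by simp
  fix x j assume x: "x \<in> dom" and L: "L \<le> F x"
  have "(\<Sum>k\<in>UNIV - {j}. p k * ln (a k \<bullet> x)) \<le> (\<Sum>k\<in>UNIV - {j}. p k * ln A)"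
    using p_pos le_A[OF x] dom_pos[OF x] A1
    by (intro sum_mono mult_left_mono ln_mono) (auto simp: less_imp_le)
  also have "\<dots> \<le> (\<Sum>k\<in>UNIV. p k * ln A)"
    using A1 p_pos by (intro sum_mono2) (auto simp: less_imp_le)
  also have "\<dots> = ln A" using p_sum by (simp flip: sum_distrib_right)
  finally have "F x \<le> p j * ln (a j \<bullet> x) + ln A"
    unfolding F_def by (subst sum.remove[of _ j]) auto
  hence "(L - ln A) / p j \<le> ln (a j \<bullet> x)"
    using L p_pos[of j] by (simp add: field_simps)
  thus "exp ((L - ln A) / p j) \<le> a j \<bullet> x"
    using dom_pos[OF x, of j] by (simp add: ln_ge_iff)
qed

lemma tendsto_F:
  assumes "z \<in> dom" "X \<longlonglongrightarrow> z"
  shows "(\<lambda>k. F (X k)) \<longlonglongrightarrow> F z"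
  unfolding F_def using assms dom_pos[OF assms(1)]
  by (intro tendsto_intros) (auto simp: less_imp_neq[symmetric])

lemma optimal_exists:
  assumes "dom \<noteq> {}"
  obtains z where "optimal z"
proof -
  obtain x0 where x0: "x0 \<in> dom" using assms by blast
  obtain c where c: "\<And>j. 0 < c j" "\<And>x j. x \<in> dom \<Longrightarrow> F x0 \<le> F x \<Longrightarrow> c j \<le> a j \<bullet> x"
    using F_superlevel_bound by metis
  \<comment> \<open>\<open>dom\<close> need not be closed; \<open>K\<close> is a compact subset of
    it that contains every point of \<open>dom\<close> at least as good as \<open>x0\<close>. Worse
    points are beaten by \<open>x0\<close>, which lies in \<open>K\<close>.\<close>
  define K where "K = prob_simplex \<inter> {x. \<forall>j. c j \<le> a j \<bullet> x}"
  have "closed {x. \<forall>j. c j \<le> a j \<bullet> x}"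
    by (intro closed_Collect_all closed_Collect_le continuous_intros)
  hence "compact K" unfolding K_def by (intro compact_Int_closed compact_prob_simplex)
  have K_dom: "K \<subseteq> dom" using c(1) by (force simp: K_def dom_def intro: less_le_trans)
  have in_K: "x \<in> K" if "x \<in> dom" "F x0 \<le> F x" for x
    using that c(2) dom_simplex by (auto simp: K_def)
  have "continuous_on K F" unfolding F_def
    using K_dom dom_pos by (intro continuous_intros) (auto simp: less_imp_neq[symmetric])
  then obtain z where z: "z \<in> K" "\<And>y. y \<in> K \<Longrightarrow> F y \<le> F z"
    using continuous_attains_sup[OF \<open>compact K\<close>, of F] in_K[OF x0] by blast
  have "F y \<le> F z" if "y \<in> dom" for y
    using z(2) in_K[OF that] z(2)[OF in_K[OF x0]] by force
  thus ?thesis using that z(1) K_dom by (auto simp: optimal_def)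
qed

section \<open>Link with the extended-valued objective\<close>

lemma objective_dom: "x \<in> dom \<Longrightarrow> objective p a x = ereal (F x)"
  using dom_pos by (simp add: objective_def F_def ext_ln_def)

lemma objective_not_dom:
  assumes "x \<notin> dom" "x \<in> prob_simplex"
  shows "objective p a x = -\<infinity>"
proof -
  obtain j where j: "\<not> 0 < a j \<bullet> x" using assms by (auto simp: dom_def)
  have "(\<Sum>k\<in>UNIV. ereal (p k) * ext_ln (a k \<bullet> x)) = -\<infinity>"
  proof (subst sum.remove[of _ j])
    \<comment> \<open>In \<open>ereal\<close>, \<open>-\<infinity> + \<infinity>\<close> equals
      \<open>\<infinity>\<close>, so the remaining terms must first be shown not to sum to
      \<open>\<infinity>\<close>.\<close>
    have "\<not> p k < 0" for k using p_pos[of k] by simp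
    hence "(\<Sum>k\<in>UNIV - {j}. ereal (p k) * ext_ln (a k \<bullet> x)) \<noteq> \<infinity>"
      by (auto simp: sum_Pinfty ext_ln_def split: if_splits)
    thus "ereal (p j) * ext_ln (a j \<bullet> x)
        + (\<Sum>k\<in>UNIV - {j}. ereal (p k) * ext_ln (a k \<bullet> x)) = -\<infinity>"
      using j p_pos[of j] by (simp add: ext_ln_def)
  qed auto
  thus ?thesis by (simp add: objective_def)
qed

lemma optimal_maximizer:
  assumes "optimal z"
  shows "z \<in> maximizers p a"
proof -
  have z: "z \<in> dom" using assms by (simp add: optimal_def)
  have "objective p a y \<le> objective p a z" if "y \<in> prob_simplex" for y
    using assms that objective_not_dom[of y] objective_dom[of y] objective_dom[OF z]
    by (cases "y \<in> dom") (auto simp: optimal_def)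
  thus ?thesis using dom_simplex[OF z]
    by (auto simp: maximizers_def is_arg_max_def not_less)
qed

section \<open>Convergence of the iterates\<close>

context
  fixes X :: "nat \<Rightarrow> real ^ 'n"
  assumes X0: "X 0 \<in> dom" and X0_pos: "\<And>i. 0 < X 0 $ i"
    and X_Suc: "\<And>t. X (Suc t) = step (X t)"
begin

lemma X_dom: "X t \<in> dom"
  by (induction t) (auto simp: X0 X_Suc step_in_dom)

lemma X_supp: "optimal z \<Longrightarrow> 0 < z $ i \<Longrightarrow> 0 < X t $ i"
  by (induction t) (auto simp: X0_pos X_Suc step_supp X_dom)

lemma rel_entropy_descent:
  "optimal z \<Longrightarrow> rel_entropy z (X (Suc t)) + (F z - F (X t)) \<le> rel_entropy z (X t)"
  unfolding X_Suc using X_dom X_supp by (intro step_descent) auto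

lemma rel_entropy_X_nonneg: "optimal z \<Longrightarrow> 0 \<le> rel_entropy z (X t)"
  using X_supp X_dom by (intro rel_entropy_nonneg dom_simplex) (auto simp: optimal_def)

lemma F_X_le: "optimal z \<Longrightarrow> F (X t) \<le> F z"
  using X_dom by (simp add: optimal_def)

lemma rel_entropy_decseq:
  assumes "optimal z"
  shows "decseq (\<lambda>t. rel_entropy z (X t))"
  using rel_entropy_descent[OF assms] F_X_le[OF assms]
  by (intro decseq_SucI) (smt (verit))

lemma F_X_tendsto:
  assumes z: "optimal z"
  shows "(\<lambda>t. F (X t)) \<longlonglongrightarrow> F z"
proof -
  have "(\<Sum>s<t. F z - F (X s)) \<le> rel_entropy z (X 0) - rel_entropy z (X t)" for t
  proof (induction t)
    case (Suc t)
    thus ?case using rel_entropy_descent[OF z, of t] by simp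
  qed simp
  hence "(\<Sum>s<t. F z - F (X s)) \<le> rel_entropy z (X 0)" for t
    using rel_entropy_X_nonneg[OF z, of t] by (smt (verit))
  hence "summable (\<lambda>t. F z - F (X t))"
    using F_X_le[OF z] by (intro summableI_nonneg_bounded) auto
  hence "(\<lambda>t. F z - F (X t)) \<longlonglongrightarrow> 0" by (rule summable_LIMSEQ_zero)
  hence "(\<lambda>t. F z - (F z - F (X t))) \<longlonglongrightarrow> F z - 0" by (intro tendsto_intros)
  thus ?thesis by simp
qed

lemma limit_point_optimal:
  assumes r: "strict_mono r" and lim: "(X \<circ> r) \<longlonglongrightarrow> y" and y: "y \<in> prob_simplex"
  shows "optimal y"
proof -
  obtain z where z: "optimal z" using optimal_exists X0 by blast
  \<comment> \<open>One descent step and monotone entropy bound \<open>F\<close> below uniformly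
    along the iterates, so every \<open>a j \<bullet> X t\<close> stays away from 0 and the limit
    point lies in \<open>dom\<close>.\<close>
  have "F z - rel_entropy z (X 0) \<le> F (X t)" for t
    using rel_entropy_descent[OF z, of t] rel_entropy_X_nonneg[OF z, of "Suc t"]
      decseqD[OF rel_entropy_decseq[OF z], of 0 t] by simp
  then obtain c where c: "\<And>j. 0 < c j" "\<And>t j. c j \<le> a j \<bullet> X t"
    using F_superlevel_bound[of "F z - rel_entropy z (X 0)"] X_dom by metis
  have "0 < a j \<bullet> y" for j
  proof -
    have "(\<lambda>k. a j \<bullet> (X \<circ> r) k) \<longlonglongrightarrow> a j \<bullet> y" using lim by (intro tendsto_intros)
    hence "c j \<le> a j \<bullet> y" using c(2) by (intro LIMSEQ_le_const) auto
    thus ?thesis using c(1)[of j] by simp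
  qed
  hence yd: "y \<in> dom" using y by (simp add: dom_def)
  have "(\<lambda>k. F ((X \<circ> r) k)) \<longlonglongrightarrow> F y" using yd lim by (rule tendsto_F)
  moreover have "(\<lambda>k. F ((X \<circ> r) k)) \<longlonglongrightarrow> F z"
    using LIMSEQ_subseq_LIMSEQ[OF F_X_tendsto[OF z] r] by (simp add: o_def)
  ultimately have "F y = F z" by (rule LIMSEQ_unique)
  thus ?thesis using z yd by (simp add: optimal_def)
qed

lemma iterates_converge: "\<exists>y\<in>maximizers p a. X \<longlonglongrightarrow> y"
proof -
  obtain y r where y: "y \<in> prob_simplex" and r: "strict_mono r" and lim: "(X \<circ> r) \<longlonglongrightarrow> y"
    using compact_imp_seq_compact[OF compact_prob_simplex] dom_simplex[OF X_dom]
    by (blast elim: seq_compactE)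
  \<comment> \<open>From here on the limit point itself is the reference maximizer for the
    entropy.\<close>
  have opt: "optimal y" using limit_point_optimal[OF r lim y] .
  obtain l where l: "(\<lambda>t. rel_entropy y (X t)) \<longlonglongrightarrow> l"
    using decseq_convergent[OF rel_entropy_decseq[OF opt]] rel_entropy_X_nonneg[OF opt] by metis
  have "(\<lambda>k. rel_entropy y ((X \<circ> r) k)) \<longlonglongrightarrow> l"
    using LIMSEQ_subseq_LIMSEQ[OF l r] by (simp add: o_def)
  hence "l = 0" using tendsto_rel_entropy_self[OF y lim] LIMSEQ_unique by blast
  hence "X \<longlonglongrightarrow> y"
    using y l X_supp[OF opt] dom_simplex[OF X_dom] by (intro tendsto_of_rel_entropy) auto
  thus ?thesis using optimal_maximizer[OF opt] by blast
qed

end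

end

theorem corollary2:
  fixes p :: "'m::finite \<Rightarrow> real"
    and a :: "'m \<Rightarrow> real ^ 'n"
    and x :: "nat \<Rightarrow> real ^ 'n"
  assumes "\<And>j. 0 < p j"
    and "(\<Sum>j\<in>UNIV. p j) = 1"
    and "\<And>j i. 0 \<le> a j $ i"
    and "\<And>j. a j \<noteq> 0"
    and "MG_iterates p a x"
  shows "\<exists>xs\<in>maximizers p a. x \<longlonglongrightarrow> xs"
proof -
  interpret mg_problem p a using assms(1-3) by unfold_locales
  have x0: "x 0 \<in> prob_simplex" "\<And>i. 0 < x 0 $ i"
    and xS: "\<And>t. x (Suc t) = step (x t)"
    using assms(5) by (auto simp: MG_iterates_def step_def vec_eq_iff)
  \<comment> \<open>Nonvanishing of \<open>a j\<close> and entrywise positivity of the start enter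
    here, placing \<open>x 0\<close> in \<open>dom\<close>.\<close>
  have "0 < a j \<bullet> x 0" for j
  proof -
    obtain i where "a j $ i \<noteq> 0" using assms(4)[of j] by (auto simp: vec_eq_iff)
    hence "0 < a j $ i" using assms(3)[of j i] by simp
    thus ?thesis unfolding inner_eq_sum
      using assms(3) x0(2) by (intro sum_pos2[of _ i]) (auto simp: less_imp_le)
  qed
  hence "x 0 \<in> dom" using x0 by (simp add: dom_def)
  thus ?thesis using iterates_converge x0(2) xS by blast
qed

end
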